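(* Let $O$ be an octonion division algebra over a field $F$, let $n\ge1$, and let $B\in M_n(O)$ be an upper triangular or a lower triangular matrix. Then $\sigma_L(B)=\mathrm{diag}(B)$, i.e. the set of left eigenvalues of $B$ in $O$ is exactly the set of diagonal entries of $B$.
   Context: An octonion algebra over a field $F$ is an 8-dimensional unital composition algebra over $F$ (when $\mathrm{char}(F)\neq2$, this is the same as an algebra obtained from $F$ by three Cayley--Dickson doublings); it is an octonion division algebra if every nonzero element is invertible. Such algebras are alternative. For $B=(b_{ij})\in M_n(O)$, $\vec v=(v_1,\dots,v_n)^T\in O^n$ and $\lambda\in O$, the vector $B\vec v$ has $i$-th entry $\sum_j b_{ij}v_j$ and $\lambda\vec v$ has $i$-th entry $\lambda v_i$. An element $\lambda\in O$ is a left eigenvalue of $B$ if $B\vec v=\lambda\vec v$ for some nonzero $\vec v\in O^n$. $\sigma_L(B)$ denotes the set of left eigenvalues of $B$, and $\mathrm{diag}(B)$ denotes the set of diagonal entries $\{b_{11},\dots,b_{nn}\}$. *)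

theory Defs
  imports "Jordan_Normal_Form.Matrix"
begin

definition bilinear_map ::
  "('f::field \<Rightarrow> 'a::ab_group_add \<Rightarrow> 'a) \<Rightarrow> ('f \<Rightarrow> 'b::ab_group_add \<Rightarrow> 'b) \<Rightarrow>
   ('a \<Rightarrow> 'a \<Rightarrow> 'b) \<Rightarrow> bool" where
  "bilinear_map s t f \<longleftrightarrow>
     (\<forall>x. Vector_Spaces.linear s t (\<lambda>y. f x y)) \<and>
     (\<forall>y. Vector_Spaces.linear s t (\<lambda>x. f x y))"

definition polar_form :: "('a::ab_group_add \<Rightarrow> 'f::field) \<Rightarrow> 'a \<Rightarrow> 'a \<Rightarrow> 'f" where
  "polar_form N x y = N (x + y) - N x - N y"

definition quadratic_form ::
  "('f::field \<Rightarrow> 'a::ab_group_add \<Rightarrow> 'a) \<Rightarrow> ('a \<Rightarrow> 'f) \<Rightarrow> bool" where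
  "quadratic_form s N \<longleftrightarrow>
     (\<forall>c x. N (s c x) = c\<^sup>2 * N x) \<and> bilinear_map s (*) (polar_form N)"

(* Nondegeneracy refers to the polar form, so that the definition is also the standard one
   in characteristic 2. *)
definition nondegenerate_form :: "('a::ab_group_add \<Rightarrow> 'f::field) \<Rightarrow> bool" where
  "nondegenerate_form N \<longleftrightarrow> (\<forall>x. (\<forall>y. polar_form N x y = 0) \<longrightarrow> x = 0)"

(* The product is an explicit operation because the library's ring classes are associative. *)
locale unital_composition_algebra =
  vector_space scale
  for scale :: "'f::field \<Rightarrow> 'a::ab_group_add \<Rightarrow> 'a" +
  fixes mul :: "'a \<Rightarrow> 'a \<Rightarrow> 'a"
    and unit :: 'a
  assumes mul_bilinear: "bilinear_map scale scale mul"
    and unit_left: "mul unit x = x"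
    and unit_right: "mul x unit = x"
    and ex_norm: "\<exists>N. quadratic_form scale N \<and> nondegenerate_form N \<and>
                      (\<forall>x y. N (mul x y) = N x * N y)"

locale octonion_algebra = unital_composition_algebra +
  assumes dim_eq_8: "dim UNIV = 8"

locale octonion_division_algebra = octonion_algebra +
  assumes ex_inverse: "x \<noteq> 0 \<Longrightarrow> \<exists>y. mul x y = unit \<and> mul y x = unit"

definition mat_vec_mul ::
  "('a::ab_group_add \<Rightarrow> 'a \<Rightarrow> 'a) \<Rightarrow> 'a mat \<Rightarrow> 'a vec \<Rightarrow> 'a vec" where
  "mat_vec_mul mul B v = vec (dim_row B) (\<lambda>i. \<Sum>j<dim_col B. mul (B $$ (i, j)) (v $ j))"

definition left_smult_vec :: "('a \<Rightarrow> 'a \<Rightarrow> 'a) \<Rightarrow> 'a \<Rightarrow> 'a vec \<Rightarrow> 'a vec" where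
  "left_smult_vec mul l v = vec (dim_vec v) (\<lambda>i. mul l (v $ i))"

definition left_eigenvalue ::
  "('a::ab_group_add \<Rightarrow> 'a \<Rightarrow> 'a) \<Rightarrow> 'a mat \<Rightarrow> 'a \<Rightarrow> bool" where
  "left_eigenvalue mul B l \<longleftrightarrow>
     (\<exists>v \<in> carrier_vec (dim_col B). v \<noteq> 0\<^sub>v (dim_col B) \<and>
        mat_vec_mul mul B v = left_smult_vec mul l v)"

definition left_spectrum :: "('a::ab_group_add \<Rightarrow> 'a \<Rightarrow> 'a) \<Rightarrow> 'a mat \<Rightarrow> 'a set" where
  "left_spectrum mul B = {l. left_eigenvalue mul B l}"

definition lower_triangular :: "'a::zero mat \<Rightarrow> bool" where
  "lower_triangular A \<longleftrightarrow> (\<forall>i < dim_row A. \<forall>j < dim_col A. i < j \<longrightarrow> A $$ (i, j) = 0)"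

end

(* The norm makes O free of zero divisors, so in dimension 8 left multiplication by a nonzero
   element is bijective; neither alternativity nor associativity is needed. Hence substitution works
   for B v - l v = 0: the first nonzero entry of v in the order of substitution forces
   b_kk - l = 0, and conversely the last k with b_kk = l gives an eigenvector with 1 at k,
   0 before k, and the later entries solved for one by one. *)
theory Submission
  imports Defs
begin

context unital_composition_algebra
begin

lemma linear_mul_left: "Vector_Spaces.linear scale scale (mul x)"
  and linear_mul_right: "Vector_Spaces.linear scale scale (\<lambda>x. mul x y)"
  using mul_bilinear unfolding bilinear_map_def by auto

lemma mul_zero_left [simp]: "mul 0 y = 0"
  using module_hom.zero[OF linear_mul_right[THEN Vector_Spaces.linear.axioms(3)]] .

lemma mul_zero_right [simp]: "mul x 0 = 0"
  using module_hom.zero[OF linear_mul_left[THEN Vector_Spaces.linear.axioms(3)]] .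

lemma mul_diff_left: "mul (x - x') y = mul x y - mul x' y"
  using module_hom.diff[OF linear_mul_right[THEN Vector_Spaces.linear.axioms(3)]] .

lemma mul_diff_right: "mul x (y - y') = mul x y - mul x y'"
  using module_hom.diff[OF linear_mul_left[THEN Vector_Spaces.linear.axioms(3)]] .

end

context octonion_division_algebra
begin

lemma unit_neq_zero: "unit \<noteq> 0"
proof
  assume "unit = 0"
  then have "x = 0" for x :: 'b
    using unit_left[of x] by simp
  then have "dim UNIV = dim {}"
    by (metis UNIV_eq_I insertI1 span_empty dim_span)
  moreover have "dim {} = 0"
    by (rule dim_unique[OF order_refl]) (auto simp: independent_empty)
  ultimately show False
    using dim_eq_8 by simp
qed

text \<open>The norms of a nonzero element and of its inverse multiply to \<open>N unit\<close>, so
  \<open>N\<close> vanishes only at 0. Multiplicativity then replaces the cancellation of an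
  inverse, which would call for associativity.\<close>

lemma no_zero_divisors:
  assumes "mul x y = 0"
  shows "x = 0 \<or> y = 0"
proof -
  obtain N where N: "quadratic_form scale N" "nondegenerate_form N"
      and mult: "\<And>x y. N (mul x y) = N x * N y"
    using ex_norm by blast
  \<comment> \<open>Otherwise \<open>N\<close>, and with it the polar form, is identically zero,
    against nondegeneracy at \<open>unit\<close>.\<close>
  have N_unit: "N unit \<noteq> 0"
  proof
    assume "N unit = 0"
    then have "N x = 0" for x :: 'b
      using mult[of unit x] by (simp add: unit_left)
    then show False
      using N(2) unit_neq_zero by (simp add: nondegenerate_form_def polar_form_def)
  qed
  have nonzero: "N z \<noteq> 0" if "z \<noteq> 0" for z
    using ex_inverse[OF that] mult N_unit by (metis mult_zero_left)
  \<comment> \<open>Homogeneity at the scalar 0 yields \<open>N 0 = 0\<close>;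
    \<open>scale 0 0\<close> must stay unsimplified to match it.\<close>
  have "N (scale 0 0) = 0"
    using N(1) by (simp add: quadratic_form_def del: scale_zero_left scale_zero_right)
  then have "N x * N y = 0"
    using assms mult[of x y] by simp
  then show ?thesis
    using nonzero by auto
qed

lemma surj_mul_left:
  assumes "c \<noteq> 0"
  shows "surj (mul c)"
proof -
  \<comment> \<open>Infinite sets have \<open>card\<close> 0, so a basis with \<open>card\<close> 8
    is finite, and injective endomorphisms are surjective.\<close>
  obtain b where b: "independent b" "span b = UNIV" "card b = 8"
    by (metis basis_exists dim_eq_8 UNIV_I UNIV_eq_I subset_UNIV subsetD)
  interpret finite_dimensional_vector_space scale b
    using b by unfold_locales (auto intro: card_ge_0_finite)
  have "inj (mul c)"
  proof (rule injI)
    fix x y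
    assume "mul c x = mul c y"
    then have "mul c (x - y) = 0"
      by (simp add: mul_diff_right)
    then show "x = y"
      using no_zero_divisors assms by fastforce
  qed
  then show ?thesis
    by (rule linear_inj_imp_surj[OF linear_mul_left])
qed

text \<open>The ranking \<open>r\<close> is the order of substitution; its two directions give lower and upper
  triangular matrices.\<close>

lemma triangular_system_solvable:
  fixes r :: "'i \<Rightarrow> 'r::linorder"
  assumes "finite J" "inj_on r J"
    and "\<And>i j. i \<in> J \<Longrightarrow> j \<in> J \<Longrightarrow> r i < r j \<Longrightarrow> a i j = 0"
    and "\<And>i. i \<in> J \<Longrightarrow> a i i \<noteq> 0"
  shows "\<exists>v. \<forall>i\<in>J. (\<Sum>j\<in>J. mul (a i j) (v j)) = w i"
  using assms
proof (induction J rule: finite_ranking_induct[where f = r])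
  case empty
  then show ?case by simp
next
  case (insert x S)
  obtain v where v: "\<forall>i\<in>S. (\<Sum>j\<in>S. mul (a i j) (v j)) = w i"
    using insert.IH insert.prems by (auto simp: inj_on_def)
  show ?case
  \<comment> \<open>The ranking induction does not exclude \<open>x \<in> S\<close>.\<close>
  proof (cases "x \<in> S")
    case True
    then show ?thesis using v by (auto simp: insert_absorb)
  next
    case False
    \<comment> \<open>\<open>x\<close> has the highest rank, so once the unknowns in
      \<open>S\<close> are fixed, its own row determines the last one.\<close>
    obtain z where z: "mul (a x x) z = w x - (\<Sum>j\<in>S. mul (a x j) (v j))"
      using surj_mul_left[of "a x x"] insert.prems(3) by (metis insertI1 surjD)
    have upd: "(\<Sum>j\<in>S. mul (a i j) ((v(x := z)) j)) = (\<Sum>j\<in>S. mul (a i j) (v j))" for i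
      using False by (intro sum.cong) auto
    have "a i x = 0" if "i \<in> S" for i
      using that insert.prems(1,2) insert.hyps(2)[OF that] False
      by (metis inj_on_eq_iff insertCI le_neq_trans)
    then have "\<forall>i\<in>insert x S. (\<Sum>j\<in>insert x S. mul (a i j) ((v(x := z)) j)) = w i"
      using v z False insert.hyps(1) upd by (auto simp del: fun_upd_apply simp: fun_upd_same)
    then show ?thesis by blast
  qed
qed

lemma triangular_kernel_iff:
  fixes r :: "'i \<Rightarrow> 'r::linorder"
  assumes I: "finite I" "inj_on r I"
    and tri: "\<And>i j. i \<in> I \<Longrightarrow> j \<in> I \<Longrightarrow> r i < r j \<Longrightarrow> a i j = 0"
  shows "(\<exists>v. (\<exists>i\<in>I. v i \<noteq> 0) \<and> (\<forall>i\<in>I. (\<Sum>j\<in>I. mul (a i j) (v j)) = 0)) \<longleftrightarrow>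
    (\<exists>i\<in>I. a i i = 0)" (is "?K \<longleftrightarrow> ?D")
proof
  assume ?K
  then obtain v where v: "\<exists>i\<in>I. v i \<noteq> 0" "\<forall>i\<in>I. (\<Sum>j\<in>I. mul (a i j) (v j)) = 0"
    by blast
  have "finite {i \<in> I. v i \<noteq> 0}" "{i \<in> I. v i \<noteq> 0} \<noteq> {}"
    using I v by auto
  then obtain k where k: "k \<in> I" "v k \<noteq> 0" and min: "\<And>j. j \<in> I \<Longrightarrow> v j \<noteq> 0 \<Longrightarrow> r k \<le> r j"
    using ex_is_arg_min_if_finite[of "{i \<in> I. v i \<noteq> 0}" r]
    by (auto simp: is_arg_min_linorder)
  \<comment> \<open>In row \<open>k\<close>, entries of lower rank meet a zero of \<open>v\<close>
    by minimality, and those of higher rank are zero by triangularity.\<close>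
  have "mul (a k j) (v j) = 0" if "j \<in> I - {k}" for j
  proof (cases "v j = 0")
    case False
    then have "r k < r j"
      using that k min[of j] I(2) by (auto simp: inj_on_eq_iff order_less_le)
    then show ?thesis using tri k that by simp
  qed simp
  then have "(\<Sum>j\<in>I. mul (a k j) (v j)) = mul (a k k) (v k)"
    using I k by (subst sum.remove[of _ k]) auto
  then show ?D
    using v(2) k no_zero_divisors by metis
next
  assume ?D
  define Z where "Z = {i \<in> I. a i i = 0}"
  have Z: "finite Z" "Z \<noteq> {}"
    using I \<open>?D\<close> by (auto simp: Z_def)
  \<comment> \<open>The highest rank is chosen so that all diagonal coefficients beyond
    \<open>k\<close> are nonzero and the system on \<open>J\<close> is solvable.\<close>
  then obtain k where "k \<in> Z" and Max: "Max (r ` Z) = r k"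
    by (rule obtains_MAX)
  then have k: "k \<in> I" "a k k = 0"
    by (auto simp: Z_def)
  have max: "r j \<le> r k" if "j \<in> I" "a j j = 0" for j
    unfolding Max[symmetric] using that Z by (intro Max_ge) (auto simp: Z_def)
  define J where "J = {i \<in> I. r k < r i}"
  have J: "J \<subseteq> I" "k \<notin> J" "finite J"
    using I by (auto simp: J_def)
  \<comment> \<open>The right-hand side cancels column \<open>k\<close>, which contributes
    \<open>a i k\<close> once coordinate \<open>k\<close> is \<open>unit\<close>.\<close>
  have "\<exists>v. \<forall>i\<in>J. (\<Sum>j\<in>J. mul (a i j) (v j)) = - a i k"
    using J I tri max
    by (intro triangular_system_solvable[where r = r])
      (auto simp: J_def not_le[symmetric] intro: inj_on_subset)
  then obtain v where v: "\<And>i. i \<in> J \<Longrightarrow> (\<Sum>j\<in>J. mul (a i j) (v j)) = - a i k"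
    by blast
  define v' where "v' = (\<lambda>j. if j = k then unit else if j \<in> J then v j else 0)"
  have "(\<Sum>j\<in>I. mul (a i j) (v' j)) = 0" if i: "i \<in> I" for i
  proof -
    have "(\<Sum>j\<in>I. mul (a i j) (v' j)) = (\<Sum>j\<in>insert k J. mul (a i j) (v' j))"
      using I J k by (intro sum.mono_neutral_right) (auto simp: v'_def)
    also have "\<dots> = a i k + (\<Sum>j\<in>J. mul (a i j) (v' j))"
      using J by (simp add: v'_def unit_right)
    also have "(\<Sum>j\<in>J. mul (a i j) (v' j)) = (\<Sum>j\<in>J. mul (a i j) (v j))"
      using J by (intro sum.cong) (auto simp: v'_def)
    finally have eq: "(\<Sum>j\<in>I. mul (a i j) (v' j)) = a i k + (\<Sum>j\<in>J. mul (a i j) (v j))" .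
    show ?thesis
    proof (cases "i \<in> J")
      case True
      then show ?thesis using eq v by simp
    next
      case False
      then have le: "r i \<le> r k"
        using i by (auto simp: J_def)
      then have "a i j = 0" if "j \<in> J" for j
        using that i tri by (auto simp: J_def)
      \<comment> \<open>For \<open>i = k\<close> this is the choice of \<open>k\<close>, otherwise
        triangularity.\<close>
      moreover have "a i k = 0"
        using le k i tri I(2) by (metis inj_on_eq_iff order_le_less)
      ultimately show ?thesis using eq by simp
    qed
  qed
  then show ?K
    using k unit_neq_zero by (intro exI[of _ v']) (auto simp: v'_def)
qed

text \<open>Additivity of \<open>mul\<close> in its first argument absorbs \<open>l\<close> into the
  diagonal, which turns the eigenvalue equation into a kernel condition on functions of the
  index.\<close>

lemma left_eigenvalue_iff:
  assumes B: "B \<in> carrier_mat n n"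
  shows "left_eigenvalue mul B l \<longleftrightarrow>
    (\<exists>v. (\<exists>i\<in>{..<n}. v i \<noteq> 0) \<and>
      (\<forall>i\<in>{..<n}. (\<Sum>j\<in>{..<n}. mul (B $$ (i, j) - (if j = i then l else 0)) (v j)) = 0))"
    (is "_ \<longleftrightarrow> (\<exists>v. ?P v)")
proof -
  have row: "(\<Sum>j<n. mul (B $$ (i, j) - (if j = i then l else 0)) (v j)) =
      (\<Sum>j<n. mul (B $$ (i, j)) (v j)) - mul l (v i)" if "i < n" for i v
  proof -
    have "(\<Sum>j<n. mul (if j = i then l else 0) (v j)) = (\<Sum>j<n. if j = i then mul l (v j) else 0)"
      by (intro sum.cong) auto
    then show ?thesis
      using that by (simp add: mul_diff_left sum_subtractf)
  qed
  have "left_eigenvalue mul B l \<longleftrightarrow> (\<exists>v\<in>carrier_vec n. ?P (($) v))"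
    unfolding left_eigenvalue_def
    using B row by (intro bex_cong) (auto simp: vec_eq_iff mat_vec_mul_def left_smult_vec_def)
  also have "\<dots> \<longleftrightarrow> (\<exists>v. ?P v)"
  proof
    assume "\<exists>v. ?P v"
    then obtain v where "?P v" ..
    \<comment> \<open>Only the values of \<open>v\<close> below \<open>n\<close> matter, and
      \<open>vec n v\<close> keeps them.\<close>
    then have "?P (($) (vec n v))" by simp
    then show "\<exists>v\<in>carrier_vec n. ?P (($) v)"
      using vec_carrier by blast
  qed blast
  finally show ?thesis .
qed

lemma left_spectrum_triangular:
  assumes B: "B \<in> carrier_mat n n" and tri: "upper_triangular B \<or> lower_triangular B"
  shows "left_spectrum mul B = set (diag_mat B)"
proof -
  \<comment> \<open>Ranks are integers so that negation can reverse the order for upper triangular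
    matrices.\<close>
  define r where "r = (\<lambda>i. if lower_triangular B then int i else - int i)"
  have inj: "inj_on r {..<n}"
    by (auto simp: r_def inj_on_def)
  have zero: "B $$ (i, j) - (if j = i then l else 0) = 0"
    if "i \<in> {..<n}" "j \<in> {..<n}" "r i < r j" for i j l
    using that tri B
    by (auto simp: r_def lower_triangular_def upper_triangular_def split: if_splits)
  \<comment> \<open>The trivial test \<open>i = i\<close> is kept so that the term is literally the
    diagonal instance of the coefficient function.\<close>
  have "left_eigenvalue mul B l \<longleftrightarrow> (\<exists>i\<in>{..<n}. B $$ (i, i) - (if i = i then l else 0) = 0)" for l
    unfolding left_eigenvalue_iff[OF B]
    by (rule triangular_kernel_iff[OF finite_lessThan inj zero])
  then show ?thesis
    using B by (auto simp: left_spectrum_def diag_mat_def)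
qed

end

theorem proposition6p1:
  fixes scale :: "'f::field \<Rightarrow> 'a::ab_group_add \<Rightarrow> 'a"
    and mul :: "'a \<Rightarrow> 'a \<Rightarrow> 'a"
    and unit :: 'a
    and n :: nat
    and B :: "'a mat"
  assumes "octonion_division_algebra scale mul unit"
    and "n \<ge> 1"
    and "B \<in> carrier_mat n n"
    and "upper_triangular B \<or> lower_triangular B"
  shows "left_spectrum mul B = set (diag_mat B)"
  using octonion_division_algebra.left_spectrum_triangular[OF assms(1,3,4)] .

end
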